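(* Let $m=m(n)\geq 1$ be a sequence of positive integers with $m=o(\sqrt{n})$ as $n\to\infty$. For each $n$, let $P=\{p_1,\ldots,p_{n+m}\}$ be a set of $n+m$ points on a line, choose a subset of $P$ of size $m$ uniformly at random, color its points red, and color the remaining $n$ points blue. Let $\mathcal{T}_{m,n}$ and $\mathcal{S}_{m,n}$ be the size of the smallest and of the largest balanced interval, respectively. Then $\mathcal{S}_{m,n}=\mathcal{T}_{m,n}=2$ with high probability, that is, $$\lim_{n\to\infty}\mathbb{P}\left(\mathcal{S}_{m,n}=\mathcal{T}_{m,n}=2\right)=1.$$
   Context: The points of $P$ are distinct. An interval of the line is balanced if it contains at least one point of $P$ and contains the same number of red and blue points of $P$. The size of an interval is the number of points of $P$ it contains. *)

theory Defs
  imports "HOL-Probability.Probability"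
begin

text \<open>The line is the type \<^typ>\<open>real\<close>, \<open>P\<close> is the set of all points, \<open>R \<subseteq> P\<close> the red ones, and
  \<open>P - R\<close> the blue ones.  Intervals may be open, closed, half-open, degenerate or unbounded.\<close>

definition balanced :: "real set \<Rightarrow> real set \<Rightarrow> real set \<Rightarrow> bool" where
  "balanced P R I \<longleftrightarrow>
     is_interval I \<and> I \<inter> P \<noteq> {} \<and> card (I \<inter> R) = card (I \<inter> (P - R))"

definition balanced_sizes :: "real set \<Rightarrow> real set \<Rightarrow> nat set" where
  "balanced_sizes P R = {card (I \<inter> P) | I. balanced P R I}"

text \<open>For finite \<open>P\<close> with at least one red and one blue point, \<^const>\<open>balanced_sizes\<close> is finite and
  nonempty, so the following minimum and maximum are meaningful.  With no blue point there is no
  balanced interval and the values are unspecified.\<close>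

definition smallest_balanced :: "real set \<Rightarrow> real set \<Rightarrow> nat" where
  "smallest_balanced P R = Min (balanced_sizes P R)"

definition largest_balanced :: "real set \<Rightarrow> real set \<Rightarrow> nat" where
  "largest_balanced P R = Max (balanced_sizes P R)"

definition random_red :: "real set \<Rightarrow> nat \<Rightarrow> real set pmf" where
  "random_red P k = pmf_of_set {R. R \<subseteq> P \<and> card R = k}"

end

theory Submission
  imports Defs
begin

text \<open>Two adjacent points of different colours form a balanced interval of size 2, so only larger
  balanced intervals matter. If \<open>k \<ge> 2\<close> red points lie pairwise at rank distance at least 4, then they
  span at least \<open>4(k - 1) + 1 > 2k\<close> points; hence a balanced interval with \<open>2k \<ge> 4\<close> points contains
  two red points at rank distance at most 3. Among \<open>N = n + m\<close> points there are at most \<open>3N\<close> such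
  pairs, and each is entirely red with probability \<open>m(m - 1)/(N(N - 1))\<close>. By the union bound the
  failure probability is at most \<open>3m\<^sup>2/n\<close>, which tends to 0.\<close>

section \<open>Rank distances in a finite linear order\<close>

text \<open>Adding the points of \<open>A\<close> from left to right, each new maximum
  \<open>b\<close> extends the span by the half-open gap after the old maximum, which is disjoint
  from the old span and holds at least \<open>d\<close> points of \<open>P\<close>. The summand
  \<open>d\<close> on the right replaces a truncated subtraction: the span has more than
  \<open>d * (card A - 1)\<close> points.\<close>

lemma separated_set_spans_many_points:
  fixes A P :: "'a::linorder set"
  assumes "finite P" "finite A" "A \<noteq> {}" "A \<subseteq> P"
    and "\<And>p q. p \<in> A \<Longrightarrow> q \<in> A \<Longrightarrow> p < q \<Longrightarrow> d \<le> card (P \<inter> {p<..q})"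
  shows "d * card A < card (P \<inter> {Min A..Max A}) + d"
  using assms(2-)
proof (induction A rule: finite_linorder_max_induct)
  case empty
  then show ?case by simp
next
  case (insert b A)
  have b: "b \<notin> A" using insert.hyps(2) by blast
  show ?case
  proof (cases "A = {}")
    case True
    then have "P \<inter> {Min (insert b A)..Max (insert b A)} = {b}"
      using insert.prems by auto
    then show ?thesis using True by simp
  next
    case False
    have IH: "d * card A < card (P \<inter> {Min A..Max A}) + d"
      using insert False by auto
    have MaxA: "Max A \<in> A" "Max A < b" "Min A \<le> Max A"
      using insert.hyps False by auto
    have gap: "d \<le> card (P \<inter> {Max A<..b})"
      using insert.prems MaxA by auto
    have "Max (insert b A) = b"
      using insert.hyps by (intro Max_eqI) (auto intro: less_imp_le)
    moreover have "Min A \<le> b" using MaxA by order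
    then have "Min (insert b A) = Min A"
      using insert.hyps(1) False by (simp add: Min_insert min_absorb2 del: Min_le_iff)
    moreover have "P \<inter> {Min A..b} = (P \<inter> {Min A..Max A}) \<union> (P \<inter> {Max A<..b})"
      using MaxA by auto
    moreover have "card ((P \<inter> {Min A..Max A}) \<union> (P \<inter> {Max A<..b})) =
        card (P \<inter> {Min A..Max A}) + card (P \<inter> {Max A<..b})"
      using \<open>finite P\<close> by (intro card_Un_disjoint) auto
    ultimately show ?thesis
      using IH gap insert.hyps b by simp
  qed
qed

text \<open>The rank distance \<open>card (P \<inter> {p<..q})\<close> strictly increases with
  \<open>q\<close> in \<open>P\<close>, so it determines \<open>q\<close>. Summed over
  \<open>p\<close>, this bounds the number of close pairs.\<close>

lemma card_close_right_neighbours: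
  fixes P :: "'a::linorder set"
  assumes "finite P"
  shows "card {q \<in> P. p < q \<and> card (P \<inter> {p<..q}) \<le> d} \<le> d"
proof -
  let ?Q = "{q \<in> P. p < q \<and> card (P \<inter> {p<..q}) \<le> d}"
  have less: "card (P \<inter> {p<..x}) < card (P \<inter> {p<..y})" if "x \<in> ?Q" "y \<in> ?Q" "x < y" for x y
  proof (rule psubset_card_mono)
    have "y \<in> P \<inter> {p<..y}" "y \<notin> P \<inter> {p<..x}" "P \<inter> {p<..x} \<subseteq> P \<inter> {p<..y}"
      using that by auto
    then show "P \<inter> {p<..x} \<subset> P \<inter> {p<..y}" by blast
  qed (use assms in simp)
  have "inj_on (\<lambda>q. card (P \<inter> {p<..q})) ?Q"
    by (intro linorder_inj_onI' less_imp_neq less)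
  \<comment> \<open>The value 0 is excluded because \<open>q\<close> itself is counted.\<close>
  moreover have "(\<lambda>q. card (P \<inter> {p<..q})) ` ?Q \<subseteq> {1..d}"
    using assms by (force simp: Suc_le_eq card_gt_0_iff disjoint_iff)
  ultimately have "card ?Q \<le> card {1..d}"
    by (intro card_inj_on_le) auto
  then show ?thesis by simp
qed

section \<open>Balanced intervals of a fixed colouring\<close>

lemma card_balanced_interval:
  assumes "finite P" "R \<subseteq> P" "balanced P R I"
  shows "card (I \<inter> P) = 2 * card (I \<inter> R)" "card (I \<inter> R) \<ge> 1"
proof -
  have "I \<inter> P = (I \<inter> R) \<union> (I \<inter> (P - R))"
    using assms by auto
  also have "card \<dots> = card (I \<inter> R) + card (I \<inter> (P - R))"
    using assms finite_subset[OF assms(2,1)] by (intro card_Un_disjoint) auto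
  finally show *: "card (I \<inter> P) = 2 * card (I \<inter> R)"
    using assms by (simp add: balanced_def)
  have "card (I \<inter> P) > 0"
    using assms by (auto simp: balanced_def card_gt_0_iff)
  with * show "card (I \<inter> R) \<ge> 1" by linarith
qed

text \<open>A red-blue pair at minimal distance is adjacent in \<open>P\<close>: a further point
  between the two would form a closer red-blue pair with whichever of them has the other
  colour.\<close>

lemma two_in_balanced_sizes:
  assumes "finite P" "R \<subseteq> P" "R \<noteq> {}" "R \<noteq> P"
  shows "2 \<in> balanced_sizes P R"
proof -
  let ?S = "R \<times> (P - R)"
  let ?f = "\<lambda>(x, y). \<bar>x - y\<bar>"
  have S: "finite ?S" "?S \<noteq> {}"
    using assms finite_subset[OF assms(2,1)] by auto
  obtain x y where xy: "(x, y) \<in> ?S" and min: "\<And>z. z \<in> ?S \<Longrightarrow> ?f (x, y) \<le> ?f z"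
    using that[of "fst (arg_min_on ?f ?S)" "snd (arg_min_on ?f ?S)"]
      arg_min_if_finite(1)[OF S, of ?f] arg_min_least[OF S, of _ ?f] by simp
  let ?I = "{min x y..max x y}"
  have between: "z = x \<or> z = y" if z: "z \<in> P" "z \<in> ?I" for z
  proof (cases "z \<in> R")
    case True
    then show ?thesis using min[of "(z, y)"] xy z by (auto simp: min_def max_def abs_if split: if_splits)
  next
    case False
    then show ?thesis using min[of "(x, z)"] xy z by (auto simp: min_def max_def abs_if split: if_splits)
  qed
  have "x \<in> ?I" "y \<in> ?I" by auto
  then have "?I \<inter> P = {x, y}" "?I \<inter> R = {x}" "?I \<inter> (P - R) = {y}"
    using between xy assms(2) by blast+
  moreover have "x \<noteq> y" using xy by auto
  ultimately have "balanced P R ?I" "card (?I \<inter> P) = 2"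
    by (simp_all add: balanced_def is_interval_cc)
  then show ?thesis unfolding balanced_sizes_def by force
qed

lemma close_red_points_in_large_balanced_interval:
  assumes "finite P" "R \<subseteq> P" "balanced P R I" "card (I \<inter> P) \<noteq> 2"
  shows "\<exists>p\<in>R. \<exists>q\<in>R. p < q \<and> card (P \<inter> {p<..q}) \<le> 3"
proof (rule ccontr)
  assume neg: "\<not> ?thesis"
  let ?A = "I \<inter> R"
  have card: "card (I \<inter> P) = 2 * card ?A" "card ?A \<ge> 1"
    using card_balanced_interval[OF assms(1-3)] .
  then have A: "?A \<noteq> {}" "finite ?A"
    using assms finite_subset by auto
  \<comment> \<open>By \<open>neg\<close>, any two red points are at rank distance greater than 3,
    hence at least 4.\<close>
  have "4 * card ?A < card (P \<inter> {Min ?A..Max ?A}) + 4"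
    by (rule separated_set_spans_many_points) (use A assms neg in \<open>auto simp: not_le\<close>, force)
  moreover have "card (P \<inter> {Min ?A..Max ?A}) \<le> card (I \<inter> P)"
  proof (intro card_mono)
    have "Min ?A \<in> I" "Max ?A \<in> I"
      using Min_in[of ?A] Max_in[of ?A] A by auto
    then show "P \<inter> {Min ?A..Max ?A} \<subseteq> I \<inter> P"
      using assms(3) by (auto simp: balanced_def intro: mem_is_interval_1_I)
  qed (use assms in auto)
  \<comment> \<open>With \<open>k = card ?A\<close>, the bounds give
    \<open>4 * k < 2 * k + 4\<close>, so \<open>k = 1\<close> and the interval has size 2 after
    all.\<close>
  ultimately show False
    using card assms(4) by presburger
qed

lemma extremal_balanced_sizes_eq_2:
  assumes "finite P" "R \<subseteq> P" "R \<noteq> {}" "R \<noteq> P"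
    and "\<not> (\<exists>p\<in>R. \<exists>q\<in>R. p < q \<and> card (P \<inter> {p<..q}) \<le> 3)"
  shows "largest_balanced P R = 2" "smallest_balanced P R = 2"
proof -
  have "balanced_sizes P R = {2}"
    using two_in_balanced_sizes[OF assms(1-4)]
      close_red_points_in_large_balanced_interval[OF assms(1,2)] assms(5)
    unfolding balanced_sizes_def by blast
  then show "largest_balanced P R = 2" "smallest_balanced P R = 2"
    by (simp_all add: largest_balanced_def smallest_balanced_def)
qed

section \<open>Probabilities for a uniformly random red set\<close>

text \<open>Deleting \<open>T\<close> is a bijection, with inverse adding \<open>T\<close>, so only
  the remaining \<open>k - card T\<close> elements are chosen freely from
  \<open>P - T\<close>.\<close>

lemma card_subsets_containing:
  assumes "finite P" "T \<subseteq> P" "card T \<le> k"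
  shows "card {R. R \<subseteq> P \<and> card R = k \<and> T \<subseteq> R} = (card P - card T) choose (k - card T)"
proof -
  have T: "finite T" using assms finite_subset by auto
  have "bij_betw (\<lambda>R. R - T) {R. R \<subseteq> P \<and> card R = k \<and> T \<subseteq> R}
      {R. R \<subseteq> P - T \<and> card R = k - card T}"
  proof (rule bij_betw_byWitness[where f' = "\<lambda>R. R \<union> T"])
    show "(\<lambda>R. R \<union> T) ` {R. R \<subseteq> P - T \<and> card R = k - card T} \<subseteq>
        {R. R \<subseteq> P \<and> card R = k \<and> T \<subseteq> R}"
    proof clarify
      fix R assume R: "R \<subseteq> P - T" "card R = k - card T"
      then have "card (R \<union> T) = card R + card T"
        using assms T finite_subset[OF R(1)] by (intro card_Un_disjoint) auto
      then show "R \<union> T \<subseteq> P \<and> card (R \<union> T) = k \<and> T \<subseteq> R \<union> T"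
        using R assms by auto
    qed
  qed (use T in \<open>auto simp: card_Diff_subset\<close>)
  then have "card {R. R \<subseteq> P \<and> card R = k \<and> T \<subseteq> R} = card {R. R \<subseteq> P - T \<and> card R = k - card T}"
    by (rule bij_betw_same_card)
  also have "\<dots> = card (P - T) choose (k - card T)"
    using assms by (intro n_subsets) auto
  finally show ?thesis using assms T by (simp add: card_Diff_subset)
qed

text \<open>For \<open>k \<ge> 2\<close> this is a quotient of binomial coefficients. Subtracting in
  the reals lets the same formula give 0 for \<open>k = 0\<close> and \<open>k = 1\<close>, where
  the event is impossible.\<close>

lemma prob_random_red_pair:
  assumes "finite P" "k \<le> card P" "p \<in> P" "q \<in> P" "p \<noteq> q"
  shows "measure_pmf.prob (random_red P k) {R. p \<in> R \<and> q \<in> R} =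
    real k * (real k - 1) / (real (card P) * (real (card P) - 1))"
proof -
  let ?S = "{R. R \<subseteq> P \<and> card R = k}"
  let ?N = "card P"
  have card_S: "card ?S = ?N choose k"
    using assms by (intro n_subsets)
  have "finite ?S" using assms by auto
  moreover have "?S \<noteq> {}"
    using card_S assms by (metis binomial_eq_0_iff card.empty not_less)
  ultimately have prob: "measure_pmf.prob (random_red P k) {R. p \<in> R \<and> q \<in> R} =
      real (card (?S \<inter> {R. p \<in> R \<and> q \<in> R})) / real (?N choose k)"
    unfolding random_red_def by (simp add: measure_pmf_of_set card_S)
  have N2: "?N \<ge> 2"
    using card_mono[of P "{p, q}"] assms by simp
  show ?thesis
  proof (cases "k \<ge> 2")
    case True
    then obtain j M where jM: "k = Suc (Suc j)" "?N = Suc (Suc M)"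
      using N2 by (metis add_2_eq_Suc le_Suc_ex)
    have "?S \<inter> {R. p \<in> R \<and> q \<in> R} = {R. R \<subseteq> P \<and> card R = k \<and> {p, q} \<subseteq> R}" by auto
    then have "card (?S \<inter> {R. p \<in> R \<and> q \<in> R}) = M choose j"
      using card_subsets_containing[of P "{p, q}" k] assms True jM by simp
    \<comment> \<open>Two applications of the absorption identity
      \<open>k * (N choose k) = N * (N - 1 choose (k - 1))\<close>, stated without division.\<close>
    moreover have "k * (k - 1) * (?N choose k) = ?N * (?N - 1) * (M choose j)"
    proof -
      have "k * (k - 1) * (?N choose k) = (?N choose k) * k * Suc j"
        by (simp add: jM mult_ac del: binomial_Suc_Suc mult_Suc mult_Suc_right)
      also have "\<dots> = ?N * ((Suc M choose Suc j) * Suc j)"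
        using Suc_times_binomial_eq[of "Suc M" "Suc j"] jM
        by (simp only: flip: mult.assoc)
      also have "\<dots> = ?N * (?N - 1) * (M choose j)"
        using Suc_times_binomial_eq[of M j] jM by (simp only: mult.assoc diff_Suc_1)
      finally show ?thesis .
    qed
    then have "real (k * (k - 1) * (?N choose k)) = real (?N * (?N - 1) * (M choose j))"
      by (simp only:)
    then have "real k * (real k - 1) * real (?N choose k) = real ?N * (real ?N - 1) * real (M choose j)"
      using True N2 by (simp only: of_nat_mult of_nat_diff of_nat_1)
    moreover have "real (?N choose k) \<noteq> 0" "real ?N * (real ?N - 1) \<noteq> 0"
      using assms N2 by auto
    ultimately show ?thesis unfolding prob by (metis frac_eq_eq mult.commute)
  next
    case False
    have "?S \<inter> {R. p \<in> R \<and> q \<in> R} = {}"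
    proof (rule ccontr)
      assume "?S \<inter> {R. p \<in> R \<and> q \<in> R} \<noteq> {}"
      then obtain R where "R \<subseteq> P" "card R = k" "{p, q} \<subseteq> R" by auto
      then have "card {p, q} \<le> k"
        using assms by (metis card_mono finite_subset)
      then show False using False assms by simp
    qed
    moreover have "k = 0 \<or> k = 1" using False by auto
    ultimately show ?thesis unfolding prob by auto
  qed
qed

text \<open>Union bound over at most \<open>d * card P\<close> close pairs; the factor
  \<open>card P\<close> cancels against the denominator of the pair probability. Writing
  \<open>P \<inter> R\<close> makes the inclusion in the union hold for every set \<open>R\<close>,
  even outside the support.\<close>

lemma prob_close_red_points_le:
  assumes "finite P" "k \<le> card P" "card P \<ge> 2"
  shows "measure_pmf.prob (random_red P k)
      {R. \<exists>p\<in>P \<inter> R. \<exists>q\<in>P \<inter> R. p < q \<and> card (P \<inter> {p<..q}) \<le> d} \<le>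
    real d * (real k)\<^sup>2 / (real (card P) - 1)"
proof -
  let ?N = "card P"
  let ?D = "SIGMA p:P. {q \<in> P. p < q \<and> card (P \<inter> {p<..q}) \<le> d}"
  let ?E = "\<lambda>(p, q). {R. p \<in> R \<and> q \<in> R}"
  have D: "finite ?D" using assms by auto
  have "card ?D = (\<Sum>p\<in>P. card {q \<in> P. p < q \<and> card (P \<inter> {p<..q}) \<le> d})"
    using assms by simp
  also have "\<dots> \<le> (\<Sum>p\<in>P. d)"
    using assms by (intro sum_mono card_close_right_neighbours)
  finally have card_D: "card ?D \<le> d * ?N" by (simp add: mult.commute)
  have "measure_pmf.prob (random_red P k)
      {R. \<exists>p\<in>P \<inter> R. \<exists>q\<in>P \<inter> R. p < q \<and> card (P \<inter> {p<..q}) \<le> d} \<le>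
      measure_pmf.prob (random_red P k) (\<Union>z\<in>?D. ?E z)"
    by (intro measure_pmf.finite_measure_mono) auto
  also have "\<dots> \<le> (\<Sum>z\<in>?D. measure_pmf.prob (random_red P k) (?E z))"
    using D by (intro measure_pmf.finite_measure_subadditive_finite) auto
  also have "\<dots> = (\<Sum>z\<in>?D. real k * (real k - 1) / (real ?N * (real ?N - 1)))"
    using assms by (intro sum.cong) (auto simp: prob_random_red_pair)
  also have "\<dots> \<le> (\<Sum>z\<in>?D. (real k)\<^sup>2 / (real ?N * (real ?N - 1)))"
    using assms by (intro sum_mono divide_right_mono) (auto simp: power2_eq_square algebra_simps)
  also have "\<dots> = real (card ?D) * ((real k)\<^sup>2 / (real ?N * (real ?N - 1)))"
    by simp
  also have "\<dots> \<le> real (d * ?N) * ((real k)\<^sup>2 / (real ?N * (real ?N - 1)))"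
    by (intro mult_right_mono of_nat_mono card_D) (use assms in auto)
  also have "\<dots> = real d * (real k)\<^sup>2 / (real ?N - 1)"
    using assms by (auto simp: divide_simps)
  finally show ?thesis .
qed

section \<open>Quantitative bound and limit\<close>

lemma prob_extremal_balanced_sizes_ge:
  assumes "finite P" "card P = n + m" "m \<ge> 1" "n \<ge> 1"
  shows "measure_pmf.prob (random_red P m)
      {R. largest_balanced P R = 2 \<and> smallest_balanced P R = 2} \<ge> 1 - 3 * (real m)\<^sup>2 / real n"
proof -
  let ?M = "random_red P m"
  let ?good = "{R. largest_balanced P R = 2 \<and> smallest_balanced P R = 2}"
  let ?bad = "{R. \<exists>p\<in>P \<inter> R. \<exists>q\<in>P \<inter> R. p < q \<and> card (P \<inter> {p<..q}) \<le> 3}"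
  have "finite {R. R \<subseteq> P \<and> card R = m}" "{R. R \<subseteq> P \<and> card R = m} \<noteq> {}"
    using assms obtain_subset_with_card_n[of m P] by auto
  then have supp: "set_pmf ?M = {R. R \<subseteq> P \<and> card R = m}"
    unfolding random_red_def by simp
  have "R \<in> ?good" if R: "R \<subseteq> P" "card R = m" "R \<notin> ?bad" for R
  proof -
    \<comment> \<open>Both colours occur: \<open>m \<ge> 1\<close> gives a red point and
      \<open>n \<ge> 1\<close> a blue one.\<close>
    have "R \<noteq> {}" "R \<noteq> P" using R(2) assms by auto
    then show ?thesis
      using extremal_balanced_sizes_eq_2[OF assms(1) R(1)] R(1,3) by blast
  qed
  \<comment> \<open>The implication from not bad to good was shown only for \<open>R\<close> in the
    support, so monotonicity is used almost everywhere.\<close>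
  then have "measure_pmf.prob ?M (UNIV - ?bad) \<le> measure_pmf.prob ?M ?good"
    using supp by (intro measure_pmf.finite_measure_mono_AE) (auto simp: AE_measure_pmf_iff)
  moreover have "measure_pmf.prob ?M (UNIV - ?bad) = 1 - measure_pmf.prob ?M ?bad"
    using measure_pmf.prob_compl[of ?bad ?M] by simp
  moreover have "measure_pmf.prob ?M ?bad \<le> real 3 * (real m)\<^sup>2 / (real (card P) - 1)"
    using assms by (intro prob_close_red_points_le) auto
  \<comment> \<open>Here \<open>card P - 1 = n + m - 1\<close> is at least \<open>n\<close> because
    \<open>m \<ge> 1\<close>.\<close>
  moreover have "real 3 * (real m)\<^sup>2 / (real (card P) - 1) \<le> 3 * (real m)\<^sup>2 / real n"
    using assms by (intro frac_le) auto
  ultimately show ?thesis by linarith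
qed

theorem theorem6:
  fixes m :: "nat \<Rightarrow> nat" and P :: "nat \<Rightarrow> real set"
  assumes "\<And>n. m n \<ge> 1"
    and "(\<lambda>n. real (m n)) \<in> o(\<lambda>n. sqrt (real n))"
    and "\<And>n. finite (P n)"
    and "\<And>n. card (P n) = n + m n"
  shows "(\<lambda>n. measure_pmf.prob (random_red (P n) (m n))
            {R. largest_balanced (P n) R = 2 \<and> smallest_balanced (P n) R = 2}) \<longlonglongrightarrow> 1"
proof (rule tendsto_sandwich)
  have "(\<lambda>n. real (m n) / sqrt (real n)) \<longlonglongrightarrow> 0"
    using assms(2) by (rule smalloD_tendsto)
  then have "(\<lambda>n. 1 - 3 * (real (m n) / sqrt (real n))\<^sup>2) \<longlonglongrightarrow> 1 - 3 * 0\<^sup>2"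
    by (intro tendsto_intros)
  then show "(\<lambda>n. 1 - 3 * (real (m n))\<^sup>2 / real n) \<longlonglongrightarrow> 1"
    by (simp add: power_divide)
  show "\<forall>\<^sub>F n in sequentially. 1 - 3 * (real (m n))\<^sup>2 / real n \<le>
      measure_pmf.prob (random_red (P n) (m n))
        {R. largest_balanced (P n) R = 2 \<and> smallest_balanced (P n) R = 2}"
    \<comment> \<open>At \<open>n = 0\<close> there is no blue point, so the bound is claimed only
      for \<open>n \<ge> 1\<close>.\<close>
    using eventually_ge_at_top[of 1]
    by eventually_elim (use assms in \<open>intro prob_extremal_balanced_sizes_ge\<close>)
\<comment> \<open>What remains is the constant upper bound 1 on probabilities and its limit.\<close>
qed auto

end
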